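(* Let $k$ be a field and let $E=E(e_1,e_2)$ be the graded exterior algebra over $k$ on generators $e_1,e_2$ whose (integer) degrees satisfy $0<|e_1|<|e_2|$. For each integer $n\ge 0$ let $M(n)$ be the graded $E$-module with homogeneous $k$-basis $x_0,\dots,x_n,y_0,\dots,y_n$, where $x_i$ has degree $i(|e_2|-|e_1|)$ and $y_i$ has degree $|x_i|+|e_2|$, and with action $$e_1x_0=0,\qquad e_1x_{i+1}=y_i=e_2x_i\ \ (0\le i\le n-1),\qquad e_2x_n=y_n,\qquad e_1y_i=e_2y_i=0\ \ (0\le i\le n).$$ Let $M=\prod_{n=0}^{\infty}M(n)$ be the product in the category of graded $E$-modules. Then $M$ is a bounded below graded $E$-module which is not isomorphic to a coproduct (direct sum) of free modules and lightning flash modules. In particular, it is not true that every graded $E$-module is a coproduct of free modules and lightning flash modules.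
   Context: Graded means $\mathbb{Z}$-graded; $e_i$ acts on graded modules raising degree by $|e_i|$; in $E$ we have $e_1^2=e_2^2=0$, and $e_1,e_2$ commute up to the usual sign, so $E$ has $k$-basis $1,e_1,e_2,e_1e_2$. Homomorphisms and isomorphisms of graded modules preserve degree. The product in the category of graded modules is formed degreewise: $(\prod_n M(n))_d=\prod_n M(n)_d$. A graded module is bounded below if it is zero in all sufficiently negative degrees. A free module is a direct sum of (arbitrarily many) degree shifts of $E$. Lightning flash modules are the following graded $E$-modules, taken up to arbitrary shifts of degree. In each case there is a homogeneous $k$-basis consisting of elements $x_i$ and $y_i$ as listed, $e_1$ and $e_2$ act as zero on all the $y_i$, $e_2x_i=y_i$ if $y_i$ is in the basis and $e_2x_i=0$ otherwise, and $e_1x_i=y_{i-1}$ if $y_{i-1}$ is in the basis and $e_1x_i=0$ otherwise; the degrees are $|x_i|=i(|e_2|-|e_1|)$ and $|y_i|=|x_i|+|e_2|$. - $L(n,\epsilon_0,\epsilon_1)$, for an integer $n\ge 0$ and $\epsilon_0,\epsilon_1\in\{0,1\}$: basis $x_0,\dots,x_n$ and $y_0,\dots,y_{n-1}$, together with $y_{-1}$ if $\epsilon_0=1$, and together with $y_n$ if $\epsilon_1=1$. - $L(\infty,\epsilon_0)$, for $\epsilon_0\in\{0,1\}$: basis $x_i$ and $y_i$ for all $i\ge 0$, together with $y_{-1}$ if $\epsilon_0=1$. - The analogous modules infinite to the left: basis $x_i$ for all $i\le 0$ and $y_i$ for all $i\le -1$, together with $y_0$ or not. - The module infinite in both directions: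 basis $x_i,y_i$ for all $i\in\mathbb{Z}$. Thus $M(n)=L(n,0,1)$. *)

theory Defs
  imports Main "HOL-Library.Function_Algebras"
begin

text \<open>
  Throughout, \<open>d1\<close> and \<open>d2\<close> are the degrees of the exterior generators \<open>e\<^sub>1\<close> and \<open>e\<^sub>2\<close>,
  and the ground field is a type \<open>'k\<close> of class \<^class>\<open>field\<close>.
\<close>

section \<open>The graded exterior algebra on two generators\<close>

datatype ext_basis = One | E1 | E2 | E12

type_synonym 'k ext = "ext_basis \<Rightarrow> 'k"

fun ext_deg :: "int \<Rightarrow> int \<Rightarrow> ext_basis \<Rightarrow> int" where
  "ext_deg d1 d2 One = 0"
| "ext_deg d1 d2 E1 = d1"
| "ext_deg d1 d2 E2 = d2"
| "ext_deg d1 d2 E12 = d1 + d2"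

definition ext_piece :: "int \<Rightarrow> int \<Rightarrow> int \<Rightarrow> 'k::field ext set" where
  "ext_piece d1 d2 d = {r. \<forall>v. r v \<noteq> 0 \<longrightarrow> ext_deg d1 d2 v = d}"

definition ext_one :: "'k::field ext" where
  "ext_one = (\<lambda>v. if v = One then 1 else 0)"

text \<open>
  The usual (Koszul) sign, so that \<open>e\<^sub>2 e\<^sub>1 = koszul d1 d2 * e\<^sub>1 e\<^sub>2\<close>. It is used only for
  positive degrees, where the conversion to \<^typ>\<open>nat\<close> loses nothing.
\<close>

definition koszul :: "int \<Rightarrow> int \<Rightarrow> 'k::field" where
  "koszul d1 d2 = (- 1) ^ nat (d1 * d2)"

definition ext_mult :: "int \<Rightarrow> int \<Rightarrow> 'k::field ext \<Rightarrow> 'k ext \<Rightarrow> 'k ext" where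
  "ext_mult d1 d2 r s = (\<lambda>v. case v of
      One \<Rightarrow> r One * s One
    | E1 \<Rightarrow> r One * s E1 + r E1 * s One
    | E2 \<Rightarrow> r One * s E2 + r E2 * s One
    | E12 \<Rightarrow> r One * s E12 + r E12 * s One + r E1 * s E2 + koszul d1 d2 * (r E2 * s E1))"


section \<open>Graded modules\<close>

text \<open>
  A graded module is a family of abelian groups indexed by the degree, each living in the
  ambient group \<open>'v\<close>. The pieces are not required to be independent in \<open>'v\<close>: the degree is
  external data. The element \<open>act M d r x\<close> is the product of \<open>r\<close> with \<open>x\<close>, the latter
  regarded as an element of degree \<open>d\<close>. Only homogeneous \<open>r\<close> and elements of the pieces
  matter. The vector space structure is multiplication by elements of degree \<open>0\<close>.
\<close>

record ('k, 'v) gmod =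
  piece :: "int \<Rightarrow> 'v set"
  act :: "int \<Rightarrow> 'k ext \<Rightarrow> 'v \<Rightarrow> 'v"

definition graded_module :: "int \<Rightarrow> int \<Rightarrow> ('k::field, 'v::ab_group_add) gmod \<Rightarrow> bool" where
  "graded_module d1 d2 M \<longleftrightarrow>
     (\<forall>d. 0 \<in> piece M d) \<and>
     (\<forall>d. \<forall>x\<in>piece M d. \<forall>y\<in>piece M d. x + y \<in> piece M d) \<and>
     (\<forall>d. \<forall>x\<in>piece M d. - x \<in> piece M d) \<and>
     (\<forall>i d. \<forall>r\<in>ext_piece d1 d2 i. \<forall>x\<in>piece M d. act M d r x \<in> piece M (i + d)) \<and>
     (\<forall>i d. \<forall>r\<in>ext_piece d1 d2 i. \<forall>x\<in>piece M d. \<forall>y\<in>piece M d.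
        act M d r (x + y) = act M d r x + act M d r y) \<and>
     (\<forall>i d. \<forall>r\<in>ext_piece d1 d2 i. \<forall>s\<in>ext_piece d1 d2 i. \<forall>x\<in>piece M d.
        act M d (r + s) x = act M d r x + act M d s x) \<and>
     (\<forall>d. \<forall>x\<in>piece M d. act M d ext_one x = x) \<and>
     (\<forall>i j d. \<forall>r\<in>ext_piece d1 d2 i. \<forall>s\<in>ext_piece d1 d2 j. \<forall>x\<in>piece M d.
        act M d (ext_mult d1 d2 r s) x = act M (j + d) r (act M d s x))"

definition bounded_below :: "('k, 'v::zero) gmod \<Rightarrow> bool" where
  "bounded_below M \<longleftrightarrow> (\<exists>D. \<forall>d<D. piece M d = {0})"

definition gmod_iso ::
  "int \<Rightarrow> int \<Rightarrow> ('k::field, 'v::ab_group_add) gmod \<Rightarrow> ('k, 'w::ab_group_add) gmod \<Rightarrow> bool" where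
  "gmod_iso d1 d2 M N \<longleftrightarrow>
     (\<exists>\<phi> :: int \<Rightarrow> 'v \<Rightarrow> 'w.
        (\<forall>d. bij_betw (\<phi> d) (piece M d) (piece N d)) \<and>
        (\<forall>d. \<forall>x\<in>piece M d. \<forall>y\<in>piece M d. \<phi> d (x + y) = \<phi> d x + \<phi> d y) \<and>
        (\<forall>i d. \<forall>r\<in>ext_piece d1 d2 i. \<forall>x\<in>piece M d.
           \<phi> (i + d) (act M d r x) = act N d r (\<phi> d x)))"

definition gmod_shift :: "int \<Rightarrow> ('k, 'v) gmod \<Rightarrow> ('k, 'v) gmod" where
  "gmod_shift t M = \<lparr>piece = (\<lambda>d. piece M (d - t)), act = (\<lambda>d. act M (d - t))\<rparr>"

text \<open>
  Families over an index set \<open>I\<close> are functions on the index type that vanish outside \<open>I\<close>.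
\<close>

definition gmod_prod :: "'i set \<Rightarrow> ('i \<Rightarrow> ('k, 'v::zero) gmod) \<Rightarrow> ('k, 'i \<Rightarrow> 'v) gmod" where
  "gmod_prod I N =
     \<lparr>piece = (\<lambda>d. {f. (\<forall>i\<in>I. f i \<in> piece (N i) d) \<and> (\<forall>i. i \<notin> I \<longrightarrow> f i = 0)}),
      act = (\<lambda>d r f i. if i \<in> I then act (N i) d r (f i) else 0)\<rparr>"

definition gmod_sum :: "'i set \<Rightarrow> ('i \<Rightarrow> ('k, 'v::zero) gmod) \<Rightarrow> ('k, 'i \<Rightarrow> 'v) gmod" where
  "gmod_sum I N =
     \<lparr>piece = (\<lambda>d. {f. (\<forall>i\<in>I. f i \<in> piece (N i) d) \<and> (\<forall>i. i \<notin> I \<longrightarrow> f i = 0) \<and>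
                       finite {i. f i \<noteq> 0}}),
      act = (\<lambda>d r f i. if i \<in> I then act (N i) d r (f i) else 0)\<rparr>"


section \<open>Free modules\<close>

definition ext_module :: "int \<Rightarrow> int \<Rightarrow> ('k::field, 'k ext) gmod" where
  "ext_module d1 d2 = \<lparr>piece = ext_piece d1 d2, act = (\<lambda>d. ext_mult d1 d2)\<rparr>"

text \<open>
  The type argument is the type from which the index set of a free module is taken. It is a
  type variable wherever free modules are used, so that the index sets are arbitrary.
\<close>

definition free_module ::
  "'j itself \<Rightarrow> int \<Rightarrow> int \<Rightarrow> ('k::field, 'v::ab_group_add) gmod \<Rightarrow> bool" where
  "free_module tj d1 d2 N \<longleftrightarrow> graded_module d1 d2 N \<and>
     (\<exists>(J :: 'j set) (t :: 'j \<Rightarrow> int).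
        gmod_iso d1 d2 N (gmod_sum J (\<lambda>j. gmod_shift (t j) (ext_module d1 d2))))"


section \<open>Lightning flash modules\<close>

datatype flash_elt = X int | Y int

fun flash_deg :: "int \<Rightarrow> int \<Rightarrow> flash_elt \<Rightarrow> int" where
  "flash_deg d1 d2 (X i) = i * (d2 - d1)"
| "flash_deg d1 d2 (Y i) = i * (d2 - d1) + d2"

text \<open>
  An element of the module with basis \<open>B\<close> is given by its coefficient function, supported on
  \<open>B\<close>. As \<open>e\<^sub>1 x\<^sub>i\<^sub>+\<^sub>1 = y\<^sub>i\<close> and \<open>e\<^sub>2 x\<^sub>i = y\<^sub>i\<close> whenever \<open>y\<^sub>i\<close> is in the basis,
  the coefficient of \<open>y\<^sub>i\<close> in \<open>e\<^sub>1 f\<close> is that of \<open>x\<^sub>i\<^sub>+\<^sub>1\<close> in \<open>f\<close>, and in \<open>e\<^sub>2 f\<close> that of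
  \<open>x\<^sub>i\<close> in \<open>f\<close>.
\<close>

definition flash_e1 :: "flash_elt set \<Rightarrow> (flash_elt \<Rightarrow> 'k::field) \<Rightarrow> (flash_elt \<Rightarrow> 'k)" where
  "flash_e1 B f = (\<lambda>v. case v of X i \<Rightarrow> 0 | Y i \<Rightarrow> if Y i \<in> B then f (X (i + 1)) else 0)"

definition flash_e2 :: "flash_elt set \<Rightarrow> (flash_elt \<Rightarrow> 'k::field) \<Rightarrow> (flash_elt \<Rightarrow> 'k)" where
  "flash_e2 B f = (\<lambda>v. case v of X i \<Rightarrow> 0 | Y i \<Rightarrow> if Y i \<in> B then f (X i) else 0)"

definition flash_module ::
  "int \<Rightarrow> int \<Rightarrow> flash_elt set \<Rightarrow> ('k::field, flash_elt \<Rightarrow> 'k) gmod" where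
  "flash_module d1 d2 B =
     \<lparr>piece = (\<lambda>d. {f. finite {v. f v \<noteq> 0} \<and> (\<forall>v. f v \<noteq> 0 \<longrightarrow> v \<in> B \<and> flash_deg d1 d2 v = d)}),
      act = (\<lambda>d r f v. r One * f v + r E1 * flash_e1 B f v + r E2 * flash_e2 B f v
                       + r E12 * flash_e1 B (flash_e2 B f) v)\<rparr>"

datatype flash = Finite nat bool bool | Right_Infinite bool | Left_Infinite bool | Bi_Infinite

fun flash_basis :: "flash \<Rightarrow> flash_elt set" where
  "flash_basis (Finite n \<epsilon>0 \<epsilon>1) =
     X ` {0..int n} \<union> Y ` {0..int n - 1} \<union>
     (if \<epsilon>0 then {Y (- 1)} else {}) \<union> (if \<epsilon>1 then {Y (int n)} else {})"
| "flash_basis (Right_Infinite \<epsilon>0) = X ` {0..} \<union> Y ` {0..} \<union> (if \<epsilon>0 then {Y (- 1)} else {})"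
| "flash_basis (Left_Infinite \<epsilon>1) = X ` {..0} \<union> Y ` {..- 1} \<union> (if \<epsilon>1 then {Y 0} else {})"
| "flash_basis Bi_Infinite = UNIV"

definition lightning_flash :: "int \<Rightarrow> int \<Rightarrow> ('k::field, 'v::ab_group_add) gmod \<Rightarrow> bool" where
  "lightning_flash d1 d2 N \<longleftrightarrow> graded_module d1 d2 N \<and>
     (\<exists>F t. gmod_iso d1 d2 N (gmod_shift t (flash_module d1 d2 (flash_basis F))))"


section \<open>Coproducts of free and lightning flash modules, and the product of the \<open>M(n)\<close>\<close>

text \<open>
  The type arguments are the types of the indices of the coproduct, of the indices inside
  the free summands, and of the ambient group of the summands.
\<close>

definition free_flash_coproduct ::
  "'i itself \<Rightarrow> 'j itself \<Rightarrow> 'w::ab_group_add itself \<Rightarrow> int \<Rightarrow> int \<Rightarrow>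
   ('k::field, 'v::ab_group_add) gmod \<Rightarrow> bool" where
  "free_flash_coproduct ti tj tw d1 d2 M \<longleftrightarrow>
     (\<exists>(I :: 'i set) (N :: 'i \<Rightarrow> ('k, 'w) gmod).
        (\<forall>i\<in>I. free_module tj d1 d2 (N i) \<or> lightning_flash d1 d2 (N i)) \<and>
        gmod_iso d1 d2 M (gmod_sum I N))"

definition M_fin :: "int \<Rightarrow> int \<Rightarrow> nat \<Rightarrow> ('k::field, flash_elt \<Rightarrow> 'k) gmod" where
  "M_fin d1 d2 n = flash_module d1 d2 (X ` {0..int n} \<union> Y ` {0..int n})"

lemma M_fin_eq_flash:
  "M_fin d1 d2 n = flash_module d1 d2 (flash_basis (Finite n False True))"
proof -
  have "{0..int n} = insert (int n) {0..int n - 1}" by auto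
  then show ?thesis unfolding M_fin_def by simp
qed

definition basis_vec :: "'b \<Rightarrow> 'b \<Rightarrow> 'k::field" where
  "basis_vec u = (\<lambda>v. if v = u then 1 else 0)"

lemma M_fin_action:
  fixes n :: nat and i d1 d2 :: int
  defines "e \<equiv> act (M_fin d1 d2 n :: ('k::field, flash_elt \<Rightarrow> 'k) gmod)"
  shows "e d (basis_vec E1) (basis_vec (X 0)) = 0"
    and "0 \<le> i \<Longrightarrow> i \<le> int n - 1 \<Longrightarrow> e d (basis_vec E1) (basis_vec (X (i + 1))) = basis_vec (Y i)"
    and "0 \<le> i \<Longrightarrow> i \<le> int n \<Longrightarrow> e d (basis_vec E2) (basis_vec (X i)) = basis_vec (Y i)"
    and "e d (basis_vec E1) (basis_vec (Y i)) = 0"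
    and "e d (basis_vec E2) (basis_vec (Y i)) = 0"
  by (auto simp: e_def M_fin_def flash_module_def basis_vec_def flash_e1_def flash_e2_def
      fun_eq_iff split: flash_elt.splits)

definition M_prod :: "int \<Rightarrow> int \<Rightarrow> ('k::field, nat \<Rightarrow> flash_elt \<Rightarrow> 'k) gmod" where
  "M_prod d1 d2 = gmod_prod UNIV (M_fin d1 d2)"

end

theory Submission imports Defs begin

text \<open>
  For a graded module \<open>P\<close> let \<open>H\<^sub>j(P) \<subseteq> P\<^sub>0\<close> consist of the \<open>c\<^sub>0\<close> which start a zigzag
  \<open>e\<^sub>2 c\<^sub>i = e\<^sub>1 c\<^sub>i\<^sub>+\<^sub>1\<close> \<open>(i < j)\<close>. This decreasing filtration is natural and splits over coproducts.
  On \<open>M\<^sub>0 = \<Prod>\<^sub>n k x\<^sub>0\<^sup>(\<^sup>n\<^sup>)\<close> it is the product filtration \<open>H\<^sub>j = \<Prod>\<^sub>n\<^sub>\<ge>\<^sub>j k x\<^sub>0\<^sup>(\<^sup>n\<^sup>)\<close>, which is separated and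
  complete with all \<open>H\<^sub>j\<close> nonzero. Suppose \<open>M\<close> is a coproduct of free modules and lightning flashes. As \<open>e\<^sub>1 e\<^sub>2 = 0\<close> on \<open>M\<close>, the free summands are
  zero; a lightning flash has dimension at most \<open>2\<close> in each degree, so separatedness forces
  \<open>H\<^sub>j\<close> of each summand to vanish for large \<open>j\<close>. One can therefore pick nonzero elements
  \<open>v\<^sub>m\<close> of distinct summands with \<open>v\<^sub>m \<in> H\<^sub>j\<^sub>m\<close> and \<open>j\<^sub>m \<rightarrow> \<infinity>\<close>; by completeness their infinite sum exists
  in \<open>M\<^sub>0\<close>, and it has infinitely many nonzero components, a contradiction.
\<close>

text \<open>The degree 0 part of the domain of the \<open>j\<close>-th power of the linear relation
  \<open>e2 a = e1 b\<close>. Each link raises the degree by \<open>d2 - d1\<close>, which dictates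
  the piece containing \<open>c i\<close>; the values of \<open>c\<close> beyond \<open>j\<close>
  are unconstrained.\<close>

definition zigzag_filtration ::
  "int \<Rightarrow> int \<Rightarrow> ('k::field, 'v) gmod \<Rightarrow> nat \<Rightarrow> 'v set" where
  "zigzag_filtration d1 d2 P j = {v. \<exists>c :: nat \<Rightarrow> 'v. c 0 = v \<and>
     (\<forall>i\<le>j. c i \<in> piece P (int i * (d2 - d1))) \<and>
     (\<forall>i<j. act P (int i * (d2 - d1)) (basis_vec E2) (c i)
          = act P (int (Suc i) * (d2 - d1)) (basis_vec E1) (c (Suc i)))}"

definition ext_scalar :: "'k::field \<Rightarrow> 'k ext" where
  "ext_scalar a = (\<lambda>v. if v = One then a else 0)"

lemma ext_pieces:
  "basis_vec E1 \<in> ext_piece d1 d2 d1" "basis_vec E2 \<in> ext_piece d1 d2 d2"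
  "basis_vec E12 \<in> ext_piece d1 d2 (d1 + d2)" "ext_scalar a \<in> ext_piece d1 d2 0"
  by (auto simp: ext_piece_def basis_vec_def ext_scalar_def)

lemma ext_mult_scalar_commute:
  "ext_mult d1 d2 (ext_scalar a) r = ext_mult d1 d2 r (ext_scalar a)"
  by (auto simp: ext_mult_def ext_scalar_def fun_eq_iff split: ext_basis.split)

lemma ext_mult_scalars:
  "ext_mult d1 d2 (ext_scalar a) (ext_scalar b) = ext_scalar (a * b)"
  by (auto simp: ext_mult_def ext_scalar_def fun_eq_iff split: ext_basis.split)

lemma ext_scalar_one: "ext_scalar 1 = ext_one"
  by (auto simp: ext_scalar_def ext_one_def)


section \<open>Graded modules\<close>

lemma graded_moduleD:
  assumes "graded_module d1 d2 P"
  shows "0 \<in> piece P d"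
    and "x \<in> piece P d \<Longrightarrow> y \<in> piece P d \<Longrightarrow> x + y \<in> piece P d"
    and "x \<in> piece P d \<Longrightarrow> - x \<in> piece P d"
    and "r \<in> ext_piece d1 d2 i \<Longrightarrow> x \<in> piece P d \<Longrightarrow> act P d r x \<in> piece P (i + d)"
    and "r \<in> ext_piece d1 d2 i \<Longrightarrow> x \<in> piece P d \<Longrightarrow> y \<in> piece P d \<Longrightarrow>
      act P d r (x + y) = act P d r x + act P d r y"
    and "x \<in> piece P d \<Longrightarrow> act P d ext_one x = x"
    and "r \<in> ext_piece d1 d2 i \<Longrightarrow> s \<in> ext_piece d1 d2 j \<Longrightarrow> x \<in> piece P d \<Longrightarrow>
      act P d (ext_mult d1 d2 r s) x = act P (j + d) r (act P d s x)"
  using assms unfolding graded_module_def by (elim conjE, metis)+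

lemma act_zero:
  assumes "graded_module d1 d2 P" "r \<in> ext_piece d1 d2 i"
  shows "act P d r 0 = 0"
  using graded_moduleD(5)[OF assms, of 0 d 0] graded_moduleD(1)[OF assms(1), of d] by simp

lemma act_minus:
  assumes "graded_module d1 d2 P" "r \<in> ext_piece d1 d2 i" "x \<in> piece P d"
  shows "act P d r (- x) = - act P d r x"
proof -
  have "act P d r x + act P d r (- x) = 0"
    using graded_moduleD(5)[OF assms(1,2,3) graded_moduleD(3)[OF assms(1,3)]]
      act_zero[OF assms(1,2), of d] by simp
  then show ?thesis by (simp add: minus_unique)
qed

lemma scalar_in_piece:
  assumes "graded_module d1 d2 P" "x \<in> piece P d"
  shows "act P d (ext_scalar a) x \<in> piece P d"
  using graded_moduleD(4)[OF assms(1) ext_pieces(4) assms(2)] by simp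

text \<open>Scalars are central in the exterior algebra, and having degree 0 they produce no
  sign.\<close>

lemma scalar_commute:
  assumes "graded_module d1 d2 P" "r \<in> ext_piece d1 d2 i" "x \<in> piece P d"
  shows "act P d r (act P d (ext_scalar a) x) = act P (i + d) (ext_scalar a) (act P d r x)"
  using graded_moduleD(7)[OF assms(1) ext_pieces(4) assms(2,3)]
    graded_moduleD(7)[OF assms(1,2) ext_pieces(4) assms(3)]
  by (simp add: ext_mult_scalar_commute)

lemma scalar_scalar:
  assumes "graded_module d1 d2 P" "x \<in> piece P d"
  shows "act P d (ext_scalar a) (act P d (ext_scalar b) x) = act P d (ext_scalar (a * b)) x"
  using graded_moduleD(7)[OF assms(1) ext_pieces(4) ext_pieces(4) assms(2)]
  by (simp add: ext_mult_scalars)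

lemma scalar_inverse:
  assumes "graded_module d1 d2 P" "x \<in> piece P d" "a \<noteq> 0"
  shows "x = act P d (ext_scalar (1 / a)) (act P d (ext_scalar a) x)"
  using scalar_scalar[OF assms(1,2)] graded_moduleD(6)[OF assms(1,2)] assms(3)
  by (simp add: ext_scalar_one)

section \<open>Stability and naturality of the zigzag filtration\<close>

lemma filtration_piece: "v \<in> zigzag_filtration d1 d2 P j \<Longrightarrow> v \<in> piece P 0"
  unfolding zigzag_filtration_def by fastforce

lemma filtration_antimono:
  "v \<in> zigzag_filtration d1 d2 P j \<Longrightarrow> i \<le> j \<Longrightarrow> v \<in> zigzag_filtration d1 d2 P i"
  unfolding zigzag_filtration_def
  by (elim CollectE exE conjE, intro CollectI exI conjI, assumption) simp_all

text \<open>The two sides of a zigzag equation, \<open>e2 (c i)\<close> and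
  \<open>e1 (c (Suc i))\<close>, lie in the same degree, so a degree-indexed map is applied to both
  with the same index.\<close>

lemma zigzag_degree: "d2 + int i * (d2 - d1) = d1 + int (Suc i) * (d2 - d1)"
  by (simp add: algebra_simps)

lemma filtration_add:
  assumes P: "graded_module d1 d2 P"
    and "v \<in> zigzag_filtration d1 d2 P j" "w \<in> zigzag_filtration d1 d2 P j"
  shows "v + w \<in> zigzag_filtration d1 d2 P j"
proof -
  obtain c where c: "c 0 = v" "\<forall>i\<le>j. c i \<in> piece P (int i * (d2 - d1))"
    "\<forall>i<j. act P (int i * (d2 - d1)) (basis_vec E2) (c i)
          = act P (int (Suc i) * (d2 - d1)) (basis_vec E1) (c (Suc i))"
    using assms(2) unfolding zigzag_filtration_def by blast
  obtain e where e: "e 0 = w" "\<forall>i\<le>j. e i \<in> piece P (int i * (d2 - d1))"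
    "\<forall>i<j. act P (int i * (d2 - d1)) (basis_vec E2) (e i)
          = act P (int (Suc i) * (d2 - d1)) (basis_vec E1) (e (Suc i))"
    using assms(3) unfolding zigzag_filtration_def by blast
  show ?thesis unfolding zigzag_filtration_def
  proof (rule CollectI, intro exI conjI allI impI)
    show "c 0 + e 0 = v + w" using c e by simp
    show "c i + e i \<in> piece P (int i * (d2 - d1))" if "i \<le> j" for i
      using graded_moduleD(2)[OF P] c(2) e(2) that by blast
    show "act P (int i * (d2 - d1)) (basis_vec E2) (c i + e i)
          = act P (int (Suc i) * (d2 - d1)) (basis_vec E1) (c (Suc i) + e (Suc i))"
      if "i < j" for i
    proof -
      have "c i \<in> piece P (int i * (d2 - d1))" "e i \<in> piece P (int i * (d2 - d1))"
        "c (Suc i) \<in> piece P (int (Suc i) * (d2 - d1))"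
        "e (Suc i) \<in> piece P (int (Suc i) * (d2 - d1))"
        using c(2) e(2) that by (meson Suc_leI less_imp_le)+
      then show ?thesis
        using graded_moduleD(5)[OF P ext_pieces(1)] graded_moduleD(5)[OF P ext_pieces(2)]
          c(3) e(3) that by metis
    qed
  qed
qed

text \<open>Naturality: applying \<open>f\<close> termwise to a zigzag gives a zigzag. This one
  lemma serves scalars, negation, the projections and inclusions of a coproduct, and both directions
  of an isomorphism.\<close>

lemma filtration_map:
  fixes f :: "int \<Rightarrow> 'v \<Rightarrow> 'w"
  assumes v: "v \<in> zigzag_filtration d1 d2 (P :: ('k::field, 'v) gmod) j"
    and f: "\<And>d x. x \<in> piece P d \<Longrightarrow> f d x \<in> piece Q d"
    and f1: "\<And>d x. x \<in> piece P d \<Longrightarrow>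
      f (d1 + d) (act P d (basis_vec E1) x) = act Q d (basis_vec E1) (f d x)"
    and f2: "\<And>d x. x \<in> piece P d \<Longrightarrow>
      f (d2 + d) (act P d (basis_vec E2) x) = act Q d (basis_vec E2) (f d x)"
  shows "f 0 v \<in> zigzag_filtration d1 d2 Q j"
proof -
  obtain c where c: "c 0 = v" "\<forall>i\<le>j. c i \<in> piece P (int i * (d2 - d1))"
    "\<forall>i<j. act P (int i * (d2 - d1)) (basis_vec E2) (c i)
          = act P (int (Suc i) * (d2 - d1)) (basis_vec E1) (c (Suc i))"
    using v unfolding zigzag_filtration_def by blast
  show ?thesis unfolding zigzag_filtration_def
  proof (rule CollectI, intro exI conjI allI impI)
    show "f (int 0 * (d2 - d1)) (c 0) = f 0 v" using c by simp
    show "f (int i * (d2 - d1)) (c i) \<in> piece Q (int i * (d2 - d1))" if "i \<le> j" for i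
      using f c(2) that by blast
    show "act Q (int i * (d2 - d1)) (basis_vec E2) (f (int i * (d2 - d1)) (c i))
        = act Q (int (Suc i) * (d2 - d1)) (basis_vec E1) (f (int (Suc i) * (d2 - d1)) (c (Suc i)))"
      if "i < j" for i
    proof -
      have "c i \<in> piece P (int i * (d2 - d1))"
        "c (Suc i) \<in> piece P (int (Suc i) * (d2 - d1))"
        using c(2) that by (meson Suc_leI less_imp_le)+
      then show ?thesis using f1 f2 c(3) that zigzag_degree by metis
    qed
  qed
qed

lemma filtration_scalar:
  assumes P: "graded_module d1 d2 P" and v: "v \<in> zigzag_filtration d1 d2 P j"
  shows "act P 0 (ext_scalar a) v \<in> zigzag_filtration d1 d2 P j"
  by (rule filtration_map[OF v, where f = "\<lambda>d. act P d (ext_scalar a)"])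
    (simp_all add: scalar_in_piece[OF P] scalar_commute[OF P ext_pieces(1)]
      scalar_commute[OF P ext_pieces(2)])

lemma filtration_minus:
  assumes P: "graded_module d1 d2 P" and v: "v \<in> zigzag_filtration d1 d2 P j"
  shows "- v \<in> zigzag_filtration d1 d2 P j"
  by (rule filtration_map[OF v, where f = "\<lambda>d. uminus"])
    (simp_all add: graded_moduleD(3)[OF P] act_minus[OF P ext_pieces(1)]
      act_minus[OF P ext_pieces(2)])


section \<open>Isomorphisms and coproducts\<close>

lemma gmod_isoE:
  assumes "gmod_iso d1 d2 P Q"
  obtains \<phi> where "\<And>d. bij_betw (\<phi> d) (piece P d) (piece Q d)"
    and "\<And>d x y. x \<in> piece P d \<Longrightarrow> y \<in> piece P d \<Longrightarrow> \<phi> d (x + y) = \<phi> d x + \<phi> d y"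
    and "\<And>i d r x. r \<in> ext_piece d1 d2 i \<Longrightarrow> x \<in> piece P d \<Longrightarrow>
      \<phi> (i + d) (act P d r x) = act Q d r (\<phi> d x)"
  using assms unfolding gmod_iso_def by blast

lemma additive_zero:
  fixes g :: "'v::ab_group_add \<Rightarrow> 'w::ab_group_add"
  assumes "\<And>x y. x \<in> A \<Longrightarrow> y \<in> A \<Longrightarrow> g (x + y) = g x + g y" "0 \<in> A"
  shows "g 0 = 0"
  using assms(1)[OF assms(2,2)] by simp

text \<open>Together with \<open>filtration_single\<close> this expresses that the filtration splits
  over coproducts: projections and inclusions both respect it.\<close>

lemma filtration_sum_component:
  assumes "f \<in> zigzag_filtration d1 d2 (gmod_sum I N) j" "i \<in> I"
  shows "f i \<in> zigzag_filtration d1 d2 (N i) j"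
  by (rule filtration_map[OF assms(1), where f = "\<lambda>d f. f i"])
    (use assms(2) in \<open>auto simp: gmod_sum_def\<close>)

definition single :: "'i \<Rightarrow> 'v \<Rightarrow> 'i \<Rightarrow> 'v::zero" where
  "single i v = (\<lambda>l. if l = i then v else 0)"

lemma single_simps [simp]: "single i v i = v" "l \<noteq> i \<Longrightarrow> single i v l = 0"
  by (simp_all add: single_def)

lemma single_in_piece:
  assumes "\<And>l. l \<in> I \<Longrightarrow> 0 \<in> piece (N l) d" "i \<in> I" "v \<in> piece (N i) d"
  shows "single i v \<in> piece (gmod_sum I N) d"
proof -
  have "{l. single i v l \<noteq> 0} \<subseteq> {i}" by (auto simp: single_def)
  then have "finite {l. single i v l \<noteq> 0}" by (rule finite_subset) simp
  then show ?thesis using assms by (auto simp: gmod_sum_def single_def)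
qed

lemma act_single:
  assumes "\<And>l. l \<in> I \<Longrightarrow> act (N l) d r 0 = 0" "i \<in> I"
  shows "act (gmod_sum I N) d r (single i v) = single i (act (N i) d r v)"
  using assms by (auto simp: gmod_sum_def single_def fun_eq_iff)

lemma filtration_single:
  assumes N: "\<And>l. l \<in> I \<Longrightarrow> graded_module d1 d2 (N l)"
    and "i \<in> I" "v \<in> zigzag_filtration d1 d2 (N i) j"
  shows "single i v \<in> zigzag_filtration d1 d2 (gmod_sum I N) j"
proof (rule filtration_map[OF assms(3), where f = "\<lambda>d. single i"])
  show "single i x \<in> piece (gmod_sum I N) d" if "x \<in> piece (N i) d" for d x
    by (rule single_in_piece) (use graded_moduleD(1)[OF N] assms(2) that in auto)
  show "single i (act (N i) d (basis_vec E1) x)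
      = act (gmod_sum I N) d (basis_vec E1) (single i x)" for d x
    by (rule act_single[symmetric]) (use act_zero[OF N ext_pieces(1)] assms(2) in auto)
  show "single i (act (N i) d (basis_vec E2) x)
      = act (gmod_sum I N) d (basis_vec E2) (single i x)" for d x
    by (rule act_single[symmetric]) (use act_zero[OF N ext_pieces(2)] assms(2) in auto)
qed


section \<open>The summands\<close>

text \<open>A nonzero element forces at least one copy of the exterior algebra to occur, and there
  \<open>e1 e2\<close> maps the generator to a nonzero element.\<close>

lemma free_module_trivial:
  fixes N :: "('k::field, 'v::ab_group_add) gmod"
  assumes N: "free_module tj d1 d2 N"
    and e12: "\<And>d x. x \<in> piece N d \<Longrightarrow> act N d (basis_vec E12) x = 0"
    and x: "x \<in> piece N d"
  shows "x = 0"
proof (rule ccontr)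
  assume "x \<noteq> 0"
  have gN: "graded_module d1 d2 N" using N unfolding free_module_def by simp
  obtain J :: "'a set" and t where
    "gmod_iso d1 d2 N (gmod_sum J (\<lambda>j. gmod_shift (t j) (ext_module d1 d2)))"
    using N unfolding free_module_def by blast
  then obtain \<phi> where \<phi>:
      "\<And>d. bij_betw (\<phi> d) (piece N d)
        (piece (gmod_sum J (\<lambda>j. gmod_shift (t j) (ext_module d1 d2))) d)"
      "\<And>d x y. x \<in> piece N d \<Longrightarrow> y \<in> piece N d \<Longrightarrow> \<phi> d (x + y) = \<phi> d x + \<phi> d y"
      "\<And>i d r x. r \<in> ext_piece d1 d2 i \<Longrightarrow> x \<in> piece N d \<Longrightarrow> \<phi> (i + d) (act N d r x) =
        act (gmod_sum J (\<lambda>j. gmod_shift (t j) (ext_module d1 d2))) d r (\<phi> d x)"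
    by (rule gmod_isoE) blast
  let ?F = "gmod_sum J (\<lambda>j. gmod_shift (t j) (ext_module d1 d2 :: ('k, 'k ext) gmod))"
  have \<phi>0: "\<phi> d 0 = 0" for d
    by (rule additive_zero[where A = "piece N d"]) (use \<phi>(2) graded_moduleD(1)[OF gN] in blast)+
  have "\<phi> d x \<noteq> 0"
    using \<phi>(1)[of d] \<phi>0[of d] x \<open>x \<noteq> 0\<close> graded_moduleD(1)[OF gN, of d]
    unfolding bij_betw_def inj_on_def by metis
  moreover have "\<phi> d x \<in> piece ?F d" using \<phi>(1)[of d] x by (auto simp: bij_betw_def)
  ultimately obtain j where j: "j \<in> J"
    by (auto simp: gmod_sum_def fun_eq_iff)
  \<comment> \<open>The generator of the \<open>j\<close>-th copy; the shift places it in degree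
    \<open>t j\<close>.\<close>
  define u where "u = single j (ext_one :: 'k ext)"
  have u: "u \<in> piece ?F (t j)" unfolding u_def
    by (rule single_in_piece) (use j in \<open>auto simp: gmod_shift_def ext_module_def ext_piece_def ext_one_def\<close>)
  then have "u \<in> \<phi> (t j) ` piece N (t j)"
    by (simp only: bij_betw_imp_surj_on[OF \<phi>(1)])
  then obtain y where y: "y \<in> piece N (t j)" "\<phi> (t j) y = u"
    by (elim imageE) simp
  have "act ?F (t j) (basis_vec E12) u = 0"
    using \<phi>(3)[OF ext_pieces(3) y(1)] e12[OF y(1)] \<phi>0 y(2) by simp
  then have "act ?F (t j) (basis_vec E12) u j E12 = 0" by simp
  then show False using j
    by (simp add: u_def gmod_sum_def gmod_shift_def ext_module_def ext_mult_def basis_vec_def ext_one_def)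
qed

section \<open>Lightning flashes have dimension at most two in each degree\<close>

lemma three_vectors_dependent:
  fixes x0 x1 x2 y0 y1 y2 :: "'k::field"
  shows "\<exists>a b c. (a \<noteq> 0 \<or> b \<noteq> 0 \<or> c \<noteq> 0) \<and> a * x0 + b * x1 + c * x2 = 0
    \<and> a * y0 + b * y1 + c * y2 = 0"
proof (cases "x1 * y2 - x2 * y1 = 0 \<and> x2 * y0 - x0 * y2 = 0 \<and> x0 * y1 - x1 * y0 = 0")
  \<comment> \<open>The cross product of the two coordinate rows is orthogonal to both and here is
    nonzero.\<close>
  case False
  then show ?thesis
    by (intro exI[of _ "x1 * y2 - x2 * y1"] exI[of _ "x2 * y0 - x0 * y2"]
        exI[of _ "x0 * y1 - x1 * y0"]) (auto simp: algebra_simps)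
next
  case True
  \<comment> \<open>All minors vanish, so the rows are proportional. A vector orthogonal to one row,
    supported on the first two entries, is orthogonal to the other because
    \<open>x0 * y1 = x1 * y0\<close>.\<close>
  consider "x0 \<noteq> 0 \<or> x1 \<noteq> 0" | "y0 \<noteq> 0 \<or> y1 \<noteq> 0" | "x0 = 0" "x1 = 0" "y0 = 0" "y1 = 0"
    by blast
  then show ?thesis
  proof cases
    case 1
    then show ?thesis using True
      by (intro exI[of _ x1] exI[of _ "- x0"] exI[of _ 0]) (auto simp: algebra_simps)
  next
    case 2
    then show ?thesis using True
      by (intro exI[of _ y1] exI[of _ "- y0"] exI[of _ 0]) (auto simp: algebra_simps)
  next
    case 3
    then show ?thesis by (intro exI[of _ 1] exI[of _ 0]) auto
  qed
qed

lemma flash_deg_inj: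
  assumes "d1 < d2"
  shows "flash_deg d1 d2 (X i) = flash_deg d1 d2 (X j) \<longleftrightarrow> i = j"
    and "flash_deg d1 d2 (Y i) = flash_deg d1 d2 (Y j) \<longleftrightarrow> i = j"
  using assms by auto

text \<open>As \<open>d2 - d1\<close> is nonzero, a degree contains at most one \<open>X\<close> and
  one \<open>Y\<close>. Two coordinates therefore determine an element, and three elements satisfy a
  nontrivial relation.\<close>

lemma lightning_flash_dependent:
  fixes N :: "('k::field, 'v::ab_group_add) gmod"
  assumes N: "lightning_flash d1 d2 N" and "d1 < d2"
    and h: "h0 \<in> piece N d" "h1 \<in> piece N d" "h2 \<in> piece N d"
  shows "\<exists>a b c. (a \<noteq> 0 \<or> b \<noteq> 0 \<or> c \<noteq> 0) \<and>
    act N d (ext_scalar a) h0 + act N d (ext_scalar b) h1 + act N d (ext_scalar c) h2 = 0"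
proof -
  have gN: "graded_module d1 d2 N" using N unfolding lightning_flash_def by simp
  obtain F t where
    "gmod_iso d1 d2 N (gmod_shift t (flash_module d1 d2 (flash_basis F)))"
    using N unfolding lightning_flash_def by blast
  then obtain \<phi> where \<phi>:
      "\<And>d. bij_betw (\<phi> d) (piece N d)
        (piece (gmod_shift t (flash_module d1 d2 (flash_basis F))) d)"
      "\<And>d x y. x \<in> piece N d \<Longrightarrow> y \<in> piece N d \<Longrightarrow> \<phi> d (x + y) = \<phi> d x + \<phi> d y"
      "\<And>i d r x. r \<in> ext_piece d1 d2 i \<Longrightarrow> x \<in> piece N d \<Longrightarrow> \<phi> (i + d) (act N d r x) =
        act (gmod_shift t (flash_module d1 d2 (flash_basis F))) d r (\<phi> d x)"
    by (rule gmod_isoE) blast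
  have scal: "\<phi> d (act N d (ext_scalar a) x) v = a * \<phi> d x v" if "x \<in> piece N d" for a x v
    using \<phi>(3)[OF ext_pieces(4) that]
    by (simp add: gmod_shift_def flash_module_def ext_scalar_def)
  \<comment> \<open>The indices of the only candidates for basis elements in this degree. If there
    is no candidate the choice is arbitrary, which is harmless: it merely adds a linear condition on
    the coefficients.\<close>
  define p where "p = (SOME i. flash_deg d1 d2 (X i) = d - t)"
  define q where "q = (SOME i. flash_deg d1 d2 (Y i) = d - t)"
  have supp: "v = X p \<or> v = Y q" if "x \<in> piece N d" "\<phi> d x v \<noteq> 0" for x v
  proof -
    have "\<phi> d x \<in> piece (gmod_shift t (flash_module d1 d2 (flash_basis F))) d"
      using \<phi>(1)[of d] that by (auto simp: bij_betw_def)
    then have deg: "flash_deg d1 d2 v = d - t"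
      using that by (simp add: gmod_shift_def flash_module_def)
    show ?thesis
    proof (cases v)
      case (X i)
      then have "flash_deg d1 d2 (X p) = d - t" unfolding p_def using deg by (metis (mono_tags) someI)
      then show ?thesis using X deg flash_deg_inj[OF \<open>d1 < d2\<close>] by metis
    next
      case (Y i)
      then have "flash_deg d1 d2 (Y q) = d - t" unfolding q_def using deg by (metis (mono_tags) someI)
      then show ?thesis using Y deg flash_deg_inj[OF \<open>d1 < d2\<close>] by metis
    qed
  qed
  obtain a b c where abc: "a \<noteq> 0 \<or> b \<noteq> 0 \<or> c \<noteq> 0"
    "a * \<phi> d h0 (X p) + b * \<phi> d h1 (X p) + c * \<phi> d h2 (X p) = 0"
    "a * \<phi> d h0 (Y q) + b * \<phi> d h1 (Y q) + c * \<phi> d h2 (Y q) = 0"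
    using three_vectors_dependent by metis
  define z where "z = act N d (ext_scalar a) h0 + act N d (ext_scalar b) h1
    + act N d (ext_scalar c) h2"
  note sp = scalar_in_piece[OF gN]
  have z: "z \<in> piece N d" unfolding z_def
    by (intro graded_moduleD(2)[OF gN] sp h)
  have "\<phi> d z = \<phi> d (act N d (ext_scalar a) h0) + \<phi> d (act N d (ext_scalar b) h1)
      + \<phi> d (act N d (ext_scalar c) h2)"
    unfolding z_def using \<phi>(2) sp h graded_moduleD(2)[OF gN] by simp
  then have val: "\<phi> d z v = a * \<phi> d h0 v + b * \<phi> d h1 v + c * \<phi> d h2 v" for v
    using scal h by simp
  have "\<phi> d z = 0"
  proof
    fix v
    show "\<phi> d z v = 0 v" using supp[OF z, of v] abc(2,3) val by fastforce
  qed
  moreover have "\<phi> d 0 = 0"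
    by (rule additive_zero[where A = "piece N d"]) (use \<phi>(2) graded_moduleD(1)[OF gN] in blast)+
  ultimately have "z = 0"
    using \<phi>(1)[of d] z graded_moduleD(1)[OF gN, of d] unfolding bij_betw_def inj_on_def by metis
  then show ?thesis using abc(1) unfolding z_def by blast
qed

text \<open>If every term of a separated decreasing filtration were nonzero, one could choose
  \<open>h0\<close>, then \<open>h1\<close> in a term missing \<open>h0\<close>, then
  \<open>h2\<close> in a term missing \<open>h1\<close>. These three would be independent, against
  the dimension bound.\<close>

lemma lightning_flash_filtration_vanishes:
  fixes N :: "('k::field, 'v::ab_group_add) gmod"
  assumes N: "lightning_flash d1 d2 N" and "d1 < d2"
    and sep: "\<And>v. (\<And>j. v \<in> zigzag_filtration d1 d2 N j) \<Longrightarrow> v = 0"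
  shows "\<exists>j. zigzag_filtration d1 d2 N j \<subseteq> {0}"
proof (rule ccontr)
  let ?H = "zigzag_filtration d1 d2 N"
  assume "\<not> ?thesis"
  then have ne: "\<exists>v. v \<in> ?H j \<and> v \<noteq> 0" for j by blast
  have gN: "graded_module d1 d2 N" using N unfolding lightning_flash_def by simp
  have drop: "\<exists>k. v \<notin> ?H k" if "v \<noteq> 0" for v
    using sep that by blast
  obtain h0 where h0: "h0 \<in> ?H 0" "h0 \<noteq> 0" using ne by blast
  obtain j where j: "h0 \<notin> ?H j" using drop h0 by blast
  obtain h1 where h1: "h1 \<in> ?H j" "h1 \<noteq> 0" using ne by blast
  obtain k where k: "h1 \<notin> ?H k" using drop h1 by blast
  \<comment> \<open>\<open>h1\<close> lies in term \<open>j\<close>, hence in all earlier ones, so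
    the term missing it comes no earlier than \<open>j\<close>.\<close>
  have "j \<le> k"
    using k filtration_antimono[OF h1(1), of k] by (cases "j \<le> k") auto
  obtain h2 where h2: "h2 \<in> ?H k" "h2 \<noteq> 0" using ne by blast
  have h2j: "h2 \<in> ?H j" using filtration_antimono[OF h2(1) \<open>j \<le> k\<close>] .
  note hp = filtration_piece[OF h0(1)] filtration_piece[OF h1(1)] filtration_piece[OF h2(1)]
  obtain a b c where abc: "a \<noteq> 0 \<or> b \<noteq> 0 \<or> c \<noteq> 0"
    "act N 0 (ext_scalar a) h0 + act N 0 (ext_scalar b) h1 + act N 0 (ext_scalar c) h2 = 0"
    using lightning_flash_dependent[OF N \<open>d1 < d2\<close> hp] by blast
  have scalar_cancel: "v \<in> ?H m" if "act N 0 (ext_scalar e) v \<in> ?H m" "e \<noteq> 0" "v \<in> piece N 0"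
    for e v m
    using scalar_inverse[OF gN that(3,2)] filtration_scalar[OF gN that(1), of "1 / e"] by simp
  have zero: "act N 0 (ext_scalar 0) v = 0" if "v \<in> piece N 0" for v
  proof -
    have "ext_scalar 0 = ext_scalar 0 + (ext_scalar 0 :: 'k ext)"
      by (auto simp: ext_scalar_def)
    then have "act N 0 (ext_scalar 0) v = act N 0 (ext_scalar 0) v + act N 0 (ext_scalar 0) v"
      using gN that ext_pieces(4)[of 0 d1 d2] unfolding graded_module_def by metis
    then show ?thesis by simp
  qed
  \<comment> \<open>Read the relation modulo \<open>?H j\<close>, which contains \<open>h1\<close>
    and \<open>h2\<close> but not \<open>h0\<close>.\<close>
  have a: "a = 0"
  proof (rule ccontr)
    assume "a \<noteq> 0"
    have "act N 0 (ext_scalar a) h0 =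
        - (act N 0 (ext_scalar b) h1 + act N 0 (ext_scalar c) h2)"
      using abc(2) by (simp only: eq_neg_iff_add_eq_0 add.assoc)
    also have "\<dots> \<in> ?H j"
      using filtration_minus filtration_add filtration_scalar gN h1(1) h2j by metis
    finally show False using scalar_cancel \<open>a \<noteq> 0\<close> hp j by blast
  qed
  \<comment> \<open>The same modulo \<open>?H k\<close>, which contains \<open>h2\<close> but not
    \<open>h1\<close>.\<close>
  have b: "b = 0"
  proof (rule ccontr)
    assume "b \<noteq> 0"
    have "act N 0 (ext_scalar b) h1 = - act N 0 (ext_scalar c) h2"
      using abc(2) a zero[OF hp(1)] by (simp only: eq_neg_iff_add_eq_0 add_0_left)
    also have "\<dots> \<in> ?H k"
      using filtration_minus filtration_scalar gN h2(1) by metis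
    finally show False using scalar_cancel \<open>b \<noteq> 0\<close> hp k by blast
  qed
  have "c \<noteq> 0" "act N 0 (ext_scalar c) h2 = 0" using abc a b zero hp by auto
  then have "h2 = 0"
    using scalar_inverse[OF gN hp(3)] act_zero[OF gN ext_pieces(4)] by metis
  then show False using h2 by simp
qed


section \<open>The product of the \<open>M(n)\<close>\<close>

text \<open>The degree is injective on the \<open>X\<close> and on the \<open>Y\<close> separately.
  The finiteness yields a pointwise description of the pieces.\<close>

lemma finite_flash_deg:
  assumes "d1 < d2"
  shows "finite {v. flash_deg d1 d2 v = d}"
proof -
  have "inj_on (flash_deg d1 d2) (range X)" "inj_on (flash_deg d1 d2) (range Y)"
    using flash_deg_inj[OF assms] by (auto intro!: inj_onI simp del: flash_deg.simps)
  then have "finite (flash_deg d1 d2 -` {d} \<inter> range X)" "finite (flash_deg d1 d2 -` {d} \<inter> range Y)"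
    by (auto intro: finite_vimage_IntI)
  moreover have "{v. flash_deg d1 d2 v = d} \<subseteq>
      (flash_deg d1 d2 -` {d} \<inter> range X) \<union> (flash_deg d1 d2 -` {d} \<inter> range Y)"
    by (auto, metis flash_elt.exhaust rangeI)
  ultimately show ?thesis by (meson finite_UnI finite_subset)
qed

lemma piece_flash_module:
  assumes "d1 < d2"
  shows "piece (flash_module d1 d2 B) d = {f :: flash_elt \<Rightarrow> 'k::field. \<forall>v. f v \<noteq> 0 \<longrightarrow> v \<in> B \<and> flash_deg d1 d2 v = d}"
proof -
  have "finite {v. f v \<noteq> 0}" if "\<forall>v. f v \<noteq> 0 \<longrightarrow> v \<in> B \<and> flash_deg d1 d2 v = d"
    for f :: "flash_elt \<Rightarrow> 'k"
    by (rule finite_subset[OF _ finite_flash_deg[OF assms, of d]]) (use that in auto)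
  then show ?thesis by (auto simp: flash_module_def)
qed

text \<open>Both operators read only coefficients of the \<open>X\<close> and produce only
  \<open>Y\<close>, so composites vanish and the Koszul sign never becomes visible in these
  modules.\<close>

lemma flash_e1_e2: "flash_e1 B (flash_e2 B f) v = 0"
  by (auto simp: flash_e1_def flash_e2_def split: flash_elt.split)

lemma graded_module_flash:
  assumes "d1 < d2"
  shows "graded_module d1 d2 (flash_module d1 d2 B :: ('k::field, flash_elt \<Rightarrow> 'k) gmod)"
  unfolding graded_module_def piece_flash_module[OF assms]
proof (intro conjI allI ballI)
  fix i d and r :: "'k ext" and f :: "flash_elt \<Rightarrow> 'k"
  assume r: "r \<in> ext_piece d1 d2 i"
    and f: "f \<in> {f. \<forall>v. f v \<noteq> 0 \<longrightarrow> v \<in> B \<and> flash_deg d1 d2 v = d}"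
  have "v \<in> B \<and> flash_deg d1 d2 v = i + d"
    if nz: "act (flash_module d1 d2 B) d r f v \<noteq> 0" for v
  proof -
    consider "r One \<noteq> 0" "f v \<noteq> 0" | "r E1 \<noteq> 0" "flash_e1 B f v \<noteq> 0"
      | "r E2 \<noteq> 0" "flash_e2 B f v \<noteq> 0"
      using nz by (force simp: flash_module_def flash_e1_e2)
    then show ?thesis
    proof cases
      case 1
      then have "i = 0" using r by (force simp: ext_piece_def)
      then show ?thesis using 1 f by simp
    next
      case 2
      then have i: "i = d1" using r by (force simp: ext_piece_def)
      obtain l where "v = Y l" "Y l \<in> B" "f (X (l + 1)) \<noteq> 0"
        using 2(2) by (auto simp: flash_e1_def split: flash_elt.splits if_splits)
      moreover from this f have "flash_deg d1 d2 (X (l + 1)) = d" by blast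
      ultimately show ?thesis using i by (auto simp: algebra_simps)
    next
      case 3
      then have i: "i = d2" using r by (force simp: ext_piece_def)
      obtain l where "v = Y l" "Y l \<in> B" "f (X l) \<noteq> 0"
        using 3(2) by (auto simp: flash_e2_def split: flash_elt.splits if_splits)
      moreover from this f have "flash_deg d1 d2 (X l) = d" by blast
      ultimately show ?thesis using i by (auto simp: algebra_simps)
    qed
  qed
  then show "act (flash_module d1 d2 B) d r f
      \<in> {f. \<forall>v. f v \<noteq> 0 \<longrightarrow> v \<in> B \<and> flash_deg d1 d2 v = i + d}" by blast
next
  fix d and f g :: "flash_elt \<Rightarrow> 'k"
  assume "f \<in> {f. \<forall>v. f v \<noteq> 0 \<longrightarrow> v \<in> B \<and> flash_deg d1 d2 v = d}"
    and "g \<in> {f. \<forall>v. f v \<noteq> 0 \<longrightarrow> v \<in> B \<and> flash_deg d1 d2 v = d}"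
  then show "f + g \<in> {f. \<forall>v. f v \<noteq> 0 \<longrightarrow> v \<in> B \<and> flash_deg d1 d2 v = d}"
    by (auto, (metis add.right_neutral)+)
qed (auto simp: flash_module_def flash_e1_def flash_e2_def ext_mult_def ext_one_def fun_eq_iff
    algebra_simps split: flash_elt.split)

section \<open>Pieces, action and filtration of the product module\<close>

lemma graded_module_prod:
  assumes "\<And>i. i \<in> I \<Longrightarrow> graded_module d1 d2 (N i)"
  shows "graded_module d1 d2 (gmod_prod I N)"
  using assms unfolding graded_module_def gmod_prod_def
  by (auto simp: fun_eq_iff)

lemma graded_module_M_prod:
  assumes "d1 < d2"
  shows "graded_module d1 d2 (M_prod d1 d2 :: ('k::field, nat \<Rightarrow> flash_elt \<Rightarrow> 'k) gmod)"
  unfolding M_prod_def M_fin_def by (intro graded_module_prod graded_module_flash assms)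

lemma piece_M_prod:
  assumes "d1 < d2"
  shows "f \<in> piece (M_prod d1 d2) d \<longleftrightarrow> (\<forall>n v. f n v \<noteq> 0 \<longrightarrow>
    v \<in> X ` {0..int n} \<union> Y ` {0..int n} \<and> flash_deg d1 d2 v = d)"
  by (simp add: M_prod_def gmod_prod_def M_fin_def piece_flash_module[OF assms])

text \<open>All \<open>Y i\<close> in the basis have positive degree, and so has \<open>X i\<close>
  unless \<open>i = 0\<close>. Hence degree 0 of the product consists of one line per factor,
  spanned by \<open>x_0\<close>.\<close>

lemma flash_deg_nonneg:
  assumes "0 < d1" "d1 < d2" "v \<in> X ` {0..int n} \<union> Y ` {0..int n}"
  shows "0 \<le> flash_deg d1 d2 v" "flash_deg d1 d2 v = 0 \<Longrightarrow> v = X 0"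
proof -
  have "0 < flash_deg d1 d2 (Y i)" if "0 \<le> i" for i
    using that assms(1,2) by (simp add: add_nonneg_pos)
  then show "0 \<le> flash_deg d1 d2 v" "flash_deg d1 d2 v = 0 \<Longrightarrow> v = X 0"
    using assms by (auto, fastforce+)
qed

lemma bounded_below_M_prod:
  assumes "0 < d1" "d1 < d2"
  shows "bounded_below (M_prod d1 d2 :: ('k::field, nat \<Rightarrow> flash_elt \<Rightarrow> 'k) gmod)"
  unfolding bounded_below_def
proof (intro exI[of _ 0] allI impI)
  fix d :: int assume "d < 0"
  show "piece (M_prod d1 d2 :: ('k, nat \<Rightarrow> flash_elt \<Rightarrow> 'k) gmod) d = {0}"
  proof (rule set_eqI)
    fix f :: "nat \<Rightarrow> flash_elt \<Rightarrow> 'k"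
    have "f \<in> piece (M_prod d1 d2) d \<longleftrightarrow> (\<forall>n v. f n v = 0)"
    proof -
      have "flash_deg d1 d2 v \<noteq> d" if "v \<in> X ` {0..int n} \<union> Y ` {0..int n}" for n v
        using flash_deg_nonneg(1)[OF assms that] \<open>d < 0\<close> by simp
      then show ?thesis unfolding piece_M_prod[OF assms(2)] by blast
    qed
    then show "f \<in> piece (M_prod d1 d2) d \<longleftrightarrow> f \<in> {0}" by (auto simp: fun_eq_iff)
  qed
qed

lemma M_prod_zero_piece:
  assumes "0 < d1" "d1 < d2"
  shows "f \<in> piece (M_prod d1 d2) 0 \<longleftrightarrow> (\<forall>n v. v \<noteq> X 0 \<longrightarrow> f n v = 0)"
proof -
  have "v \<in> X ` {0..int n} \<union> Y ` {0..int n} \<and> flash_deg d1 d2 v = 0 \<longleftrightarrow> v = X 0" for n v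
    using flash_deg_nonneg(2)[OF assms] by auto
  then show ?thesis unfolding piece_M_prod[OF assms(2)] by blast
qed

lemma act_M_prod_e1:
  "act (M_prod d1 d2) d (basis_vec E1) f n (Y i) = (if 0 \<le> i \<and> i \<le> int n then f n (X (i + 1)) else 0)"
  "act (M_prod d1 d2) d (basis_vec E1) f n (X i) = 0"
  by (auto simp: M_prod_def gmod_prod_def M_fin_def flash_module_def basis_vec_def flash_e1_def)

lemma act_M_prod_e2:
  "act (M_prod d1 d2) d (basis_vec E2) f n (Y i) = (if 0 \<le> i \<and> i \<le> int n then f n (X i) else 0)"
  "act (M_prod d1 d2) d (basis_vec E2) f n (X i) = 0"
  by (auto simp: M_prod_def gmod_prod_def M_fin_def flash_module_def basis_vec_def flash_e2_def)

lemma act_M_prod_e12: "act (M_prod d1 d2) d (basis_vec E12) f = 0"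
  by (auto simp: M_prod_def gmod_prod_def M_fin_def flash_module_def basis_vec_def flash_e1_e2 fun_eq_iff)

text \<open>In the factor \<open>M(n)\<close> a zigzag from \<open>x_0\<close> must run through
  \<open>x_1\<close>, ..., \<open>x_n\<close> and stops there, since \<open>e2 x_n = y_n\<close> is
  not in the image of \<open>e1\<close>. So \<open>x_0\<close> survives exactly in the terms
  \<open>j \<le> n\<close>.\<close>

lemma filtration_M_prod:
  fixes f :: "nat \<Rightarrow> flash_elt \<Rightarrow> 'k::field"
  assumes d: "0 < d1" "d1 < d2"
  shows "f \<in> zigzag_filtration d1 d2 (M_prod d1 d2) j \<longleftrightarrow>
    f \<in> piece (M_prod d1 d2) 0 \<and> (\<forall>n<j. f n = 0)"
proof (intro iffI conjI allI impI)
  assume f: "f \<in> zigzag_filtration d1 d2 (M_prod d1 d2) j"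
  show f0: "f \<in> piece (M_prod d1 d2) 0" using f by (rule filtration_piece)
  fix n assume n: "n < j"
  obtain c where c: "c 0 = f" "\<forall>i\<le>j. c i \<in> piece (M_prod d1 d2) (int i * (d2 - d1))"
    "\<forall>i<j. act (M_prod d1 d2) (int i * (d2 - d1)) (basis_vec E2) (c i)
          = act (M_prod d1 d2) (int (Suc i) * (d2 - d1)) (basis_vec E1) (c (Suc i))"
    using f unfolding zigzag_filtration_def by blast
  \<comment> \<open>Compare coefficients at \<open>Y i\<close>. The case \<open>i = n\<close> is
    included: \<open>y_n\<close> is in the basis, and \<open>n < j\<close> guarantees a link from
    \<open>c n\<close> to \<open>c (Suc n)\<close>.\<close>
  have step: "c i n (X (int i)) = c (Suc i) n (X (int (Suc i)))" if "i \<le> n" for i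
  proof -
    have "act (M_prod d1 d2) (int i * (d2 - d1)) (basis_vec E2) (c i) n (Y (int i))
        = act (M_prod d1 d2) (int (Suc i) * (d2 - d1)) (basis_vec E1) (c (Suc i)) n (Y (int i))"
      using c(3) that n by simp
    then show ?thesis using that by (simp add: act_M_prod_e1 act_M_prod_e2 add.commute)
  qed
  have "i \<le> Suc n \<Longrightarrow> f n (X 0) = c i n (X (int i))" for i
    by (induction i) (use c(1) step in auto)
  then have "f n (X 0) = c (Suc n) n (X (int (Suc n)))" by blast
  \<comment> \<open>\<open>x_{n+1}\<close> is not in the basis of \<open>M(n)\<close>.\<close>
  moreover have "c (Suc n) n (X (int (Suc n))) = 0"
  proof (rule ccontr)
    assume "c (Suc n) n (X (int (Suc n))) \<noteq> 0"
    moreover have "c (Suc n) \<in> piece (M_prod d1 d2) (int (Suc n) * (d2 - d1))"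
      using c(2)[rule_format, of "Suc n"] n by simp
    ultimately have "X (int (Suc n)) \<in> X ` {0..int n} \<union> Y ` {0..int n}"
      unfolding piece_M_prod[OF d(2)] by blast
    then show False by auto
  qed
  ultimately show "f n = 0" using f0 unfolding M_prod_zero_piece[OF d]
    by (metis ext zero_fun_apply)
next
  assume f: "f \<in> piece (M_prod d1 d2) 0 \<and> (\<forall>n<j. f n = 0)"
  \<comment> \<open>The coefficient of \<open>x_0\<close> is carried along to \<open>x_i\<close> in
    every factor. The factors with \<open>n < i\<close> contribute nothing, because \<open>f\<close>
    vanishes there for \<open>i \<le> j\<close>.\<close>
  define c where "c = (\<lambda>(i::nat) n v. if v = X (int i) then f n (X 0) else 0)"
  show "f \<in> zigzag_filtration d1 d2 (M_prod d1 d2) j"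
    unfolding zigzag_filtration_def
  proof (rule CollectI, intro exI conjI allI impI)
    show "c 0 = f" using f unfolding M_prod_zero_piece[OF d] by (auto simp: c_def fun_eq_iff)
    fix i
    show "c i \<in> piece (M_prod d1 d2) (int i * (d2 - d1))" if "i \<le> j"
    proof -
      have "i \<le> n" if "f n (X 0) \<noteq> 0" for n
        using f that \<open>i \<le> j\<close> by (metis le_trans not_le_imp_less zero_fun_apply)
      then show ?thesis unfolding piece_M_prod[OF d(2)] by (auto simp: c_def)
    qed
    show "act (M_prod d1 d2) (int i * (d2 - d1)) (basis_vec E2) (c i)
        = act (M_prod d1 d2) (int (Suc i) * (d2 - d1)) (basis_vec E1) (c (Suc i))"
    proof (intro ext)
      fix n v
      show "act (M_prod d1 d2) (int i * (d2 - d1)) (basis_vec E2) (c i) n v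
        = act (M_prod d1 d2) (int (Suc i) * (d2 - d1)) (basis_vec E1) (c (Suc i)) n v"
        by (cases v) (auto simp: act_M_prod_e1 act_M_prod_e2 c_def)
    qed
  qed
qed

section \<open>The contradiction: an infinite sum spread over distinct summands\<close>

lemma M_prod_not_coproduct:
  assumes d: "0 < d1" "d1 < d2"
  shows "\<not> free_flash_coproduct TYPE('i) TYPE('j) TYPE('w::ab_group_add) d1 d2
    (M_prod d1 d2 :: ('k::field, nat \<Rightarrow> flash_elt \<Rightarrow> 'k) gmod)"
proof
  let ?M = "M_prod d1 d2 :: ('k, nat \<Rightarrow> flash_elt \<Rightarrow> 'k) gmod"
  assume "free_flash_coproduct TYPE('i) TYPE('j) TYPE('w) d1 d2 ?M"
  then obtain I :: "'i set" and N :: "'i \<Rightarrow> ('k, 'w) gmod" where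
    N: "\<And>i. i \<in> I \<Longrightarrow> free_module TYPE('j) d1 d2 (N i) \<or> lightning_flash d1 d2 (N i)"
    and iso: "gmod_iso d1 d2 ?M (gmod_sum I N)"
    unfolding free_flash_coproduct_def by blast
  let ?S = "gmod_sum I N"
  let ?H = "zigzag_filtration d1 d2"
  have gM: "graded_module d1 d2 ?M" by (rule graded_module_M_prod[OF d(2)])
  have gN: "graded_module d1 d2 (N i)" if "i \<in> I" for i
    using N[OF that] unfolding free_module_def lightning_flash_def by blast
  obtain \<phi> where \<phi>: "\<And>d. bij_betw (\<phi> d) (piece ?M d) (piece ?S d)"
    "\<And>d x y. x \<in> piece ?M d \<Longrightarrow> y \<in> piece ?M d \<Longrightarrow> \<phi> d (x + y) = \<phi> d x + \<phi> d y"
    "\<And>i d r x. r \<in> ext_piece d1 d2 i \<Longrightarrow> x \<in> piece ?M d \<Longrightarrow>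
      \<phi> (i + d) (act ?M d r x) = act ?S d r (\<phi> d x)"
    using iso by (rule gmod_isoE) blast
  define \<psi> where "\<psi> d = the_inv_into (piece ?M d) (\<phi> d)" for d
  have \<psi>: "\<psi> d y \<in> piece ?M d" "\<phi> d (\<psi> d y) = y" if "y \<in> piece ?S d" for d y
    using \<phi>(1)[of d] that f_the_inv_into_f_bij_betw
      bij_betwE[OF bij_betw_the_inv_into[OF \<phi>(1)[of d]]] unfolding \<psi>_def by metis+
  have \<psi>\<phi>: "\<psi> d (\<phi> d x) = x" if "x \<in> piece ?M d" for d x
    using \<phi>(1)[of d] that unfolding \<psi>_def by (simp add: bij_betw_def the_inv_into_f_f)
  have \<phi>0: "\<phi> d 0 = 0" for d
    by (rule additive_zero[where A = "piece ?M d"]) (use \<phi>(2) graded_moduleD(1)[OF gM] in blast)+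
  have \<psi>_act: "\<psi> (i + d) (act ?S d r y) = act ?M d r (\<psi> d y)"
    if "r \<in> ext_piece d1 d2 i" "y \<in> piece ?S d" for i d r y
    using \<phi>(3)[OF that(1) \<psi>(1)[OF that(2)]] \<psi>(2)[OF that(2)]
      \<psi>\<phi>[OF graded_moduleD(4)[OF gM that(1) \<psi>(1)[OF that(2)]]] by simp
  have H\<phi>: "\<phi> 0 v \<in> ?H ?S j" if "v \<in> ?H ?M j" for v j
    by (rule filtration_map[OF that])
      (use \<phi>(3) ext_pieces bij_betwE[OF \<phi>(1)] in blast)+
  have H\<psi>: "\<psi> 0 v \<in> ?H ?M j" if "v \<in> ?H ?S j" for v j
    by (rule filtration_map[OF that]) (use \<psi>(1) \<psi>_act ext_pieces in blast)+

  \<comment> \<open>Free summands inherit \<open>e1 e2 = 0\<close> from the product and are zero;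
    lightning flashes inherit separatedness through the inclusion and \<open>\<psi>\<close>.\<close>
  have vanish: "\<exists>j. ?H (N i) j \<subseteq> {0}" if i: "i \<in> I" for i
  proof (cases "free_module TYPE('j) d1 d2 (N i)")
    case True
    have "act (N i) d (basis_vec E12) x = 0" if x: "x \<in> piece (N i) d" for d x
    proof -
      have s: "single i x \<in> piece ?S d"
        by (rule single_in_piece) (use graded_moduleD(1)[OF gN] i x in auto)
      have "single i (act (N i) d (basis_vec E12) x) = act ?S d (basis_vec E12) (single i x)"
        by (rule act_single[symmetric]) (use act_zero[OF gN ext_pieces(3)] i in auto)
      also have "\<dots> = 0"
        using \<phi>(3)[OF ext_pieces(3) \<psi>(1)[OF s]] \<psi>(2)[OF s] \<phi>0 by (simp add: act_M_prod_e12)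
      finally show ?thesis by (metis single_simps(1) zero_fun_apply)
    qed
    then have "x = 0" if "x \<in> ?H (N i) 0" for x
      using free_module_trivial[OF True _ filtration_piece[OF that]] by blast
    then show ?thesis by blast
  next
    case False
    then have "lightning_flash d1 d2 (N i)" using N i by blast
    then show ?thesis
    proof (rule lightning_flash_filtration_vanishes[OF _ d(2)])
      fix v assume v: "\<And>j. v \<in> ?H (N i) j"
      then have s: "single i v \<in> ?H ?S j" for j using filtration_single[of I d1 d2 N, OF gN i] by blast
      \<comment> \<open>Term \<open>Suc n\<close> is the first one that annihilates factor
        \<open>n\<close>.\<close>
      then have "\<psi> 0 (single i v) n = 0" for n
        using H\<psi>[OF s[of "Suc n"]] filtration_M_prod[OF d] by blast
      then have "\<psi> 0 (single i v) = 0" by (auto simp: fun_eq_iff)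
      then have "single i v = 0" using \<psi>(2)[OF filtration_piece[OF s]] \<phi>0 by metis
      then show "v = 0" by (metis single_simps(1) zero_fun_apply)
    qed
  qed

  have "\<exists>i v. i \<in> I \<and> v \<in> ?H (N i) j \<and> v \<noteq> 0" for j
  proof -
    \<comment> \<open>The element \<open>x_0\<close> of the single factor \<open>M(j)\<close> is a
      nonzero member of term \<open>j\<close>; some component of its image is nonzero.\<close>
    define x where "x = (\<lambda>n v. if n = j \<and> v = X 0 then 1 else 0 :: 'k)"
    have x: "x \<in> ?H ?M j"
      unfolding filtration_M_prod[OF d] M_prod_zero_piece[OF d] by (auto simp: x_def fun_eq_iff)
    have "x j (X 0) \<noteq> 0" by (simp add: x_def)
    then have "x \<noteq> 0" by (metis zero_fun_apply)
    then have "\<phi> 0 x \<noteq> 0"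
      using \<psi>\<phi>[OF filtration_piece[OF x]] \<psi>\<phi>[OF graded_moduleD(1)[OF gM]] \<phi>0 by metis
    then obtain i where i: "\<phi> 0 x i \<noteq> 0" by (auto simp: fun_eq_iff)
    have "\<phi> 0 x \<in> piece ?S 0" using H\<phi>[OF x] by (rule filtration_piece)
    then have "i \<in> I" using i by (auto simp: gmod_sum_def)
    then show ?thesis using i filtration_sum_component[OF H\<phi>[OF x]] by blast
  qed
  then obtain s u where su: "\<And>j. s j \<in> I" "\<And>j. u j \<in> ?H (N (s j)) j" "\<And>j. u j \<noteq> 0"
    by metis
  \<comment> \<open>Requiring \<open>k > j\<close> makes the iteration of \<open>g\<close> strictly
    increasing.\<close>
  have "\<exists>k>j. ?H (N (s j)) k \<subseteq> {0}" for j
  proof -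
    obtain k where "?H (N (s j)) k \<subseteq> {0}" using vanish su by blast
    then have "?H (N (s j)) (max k (Suc j)) \<subseteq> {0}"
      using filtration_antimono[of _ d1 d2 "N (s j)" "max k (Suc j)" k] by auto
    then show ?thesis by (intro exI[of _ "max k (Suc j)"]) auto
  qed
  then obtain g where g: "\<And>j. j < g j" "\<And>j. ?H (N (s j)) (g j) \<subseteq> {0}" by metis
  \<comment> \<open>With \<open>J (Suc m) = g (J m)\<close>, the summand chosen at stage
    \<open>m\<close> has zero filtration from term \<open>J (Suc m)\<close> on, so no later vector
    can lie in it.\<close>
  define J where "J m = (g ^^ m) 0" for m
  have J_Suc: "J (Suc m) = g (J m)" for m by (simp add: J_def)
  have J_mono: "strict_mono J" by (rule strict_mono_Suc_iff[THEN iffD2]) (simp add: J_Suc g)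
  have kill: "v = 0" if "v \<in> ?H (N (s (J m))) (J l)" "m < l" for v m l
  proof -
    have "J (Suc m) \<le> J l" using J_mono that(2) by (simp add: strict_mono_less_eq Suc_leI)
    then show ?thesis using filtration_antimono[OF that(1)] g(2) J_Suc by fastforce
  qed
  define w where "w m = \<psi> 0 (single (s (J m)) (u (J m)))" for m
  have S: "single (s (J m)) (u (J m)) \<in> ?H ?S (J m)" for m
    using filtration_single[of I d1 d2 N, OF gN su(1,2)] .
  have w: "w m \<in> ?H ?M (J m)" for m unfolding w_def using H\<psi> S by blast
  have \<phi>w: "\<phi> 0 (w m) = single (s (J m)) (u (J m))" for m
    unfolding w_def using \<psi>(2)[OF filtration_piece[OF S]] .
  have w_early: "w m n = 0" if "n < J m" for m n
    using w[of m] that filtration_M_prod[OF d] by blast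
  \<comment> \<open>The infinite sum of the \<open>w i\<close> for \<open>i \<ge> m\<close>: by \<open>w_early\<close> the omitted terms vanish.\<close>
  define T where "T m = (\<lambda>n v. \<Sum>i\<in>{m..n}. w i n v)" for m
  \<comment> \<open>Completeness of the product filtration: all terms of the tail lie in term
    \<open>J m\<close>, and so does their infinite sum.\<close>
  have T: "T m \<in> ?H ?M (J m)" for m
    unfolding filtration_M_prod[OF d]
  proof (intro conjI allI impI)
    have "w i \<in> piece ?M 0" for i using w by (rule filtration_piece)
    then show "T m \<in> piece ?M 0" unfolding M_prod_zero_piece[OF d] T_def by simp
    fix n assume n: "n < J m"
    have "w i n = 0" if "m \<le> i" for i
      using w_early n J_mono that by (meson less_le_trans strict_mono_less_eq)
    then show "T m n = 0" unfolding T_def by (auto simp: fun_eq_iff)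
  qed
  have T_rec: "T m = w m + T (Suc m)" for m
  proof (intro ext)
    fix n v
    show "T m n v = (w m + T (Suc m)) n v"
    proof (cases "m \<le> n")
      case True
      then show ?thesis by (simp add: T_def sum.atLeast_Suc_atMost)
    next
      case False
      \<comment> \<open>A strictly increasing \<open>J\<close> satisfies \<open>m \<le> J m\<close>;
        so in factors \<open>n < m\<close> the term \<open>w m\<close> vanishes and both tails are
        empty sums.\<close>
      then have "n < J m" using strict_mono_imp_increasing[OF J_mono, of m] by simp
      then show ?thesis using False w_early by (simp add: T_def)
    qed
  qed
  \<comment> \<open>Additivity of \<open>\<phi>\<close> says nothing about infinite sums, so terms
    are split off one at a time.\<close>
  have \<phi>T: "\<phi> 0 (T m) = single (s (J m)) (u (J m)) + \<phi> 0 (T (Suc m))" for m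
    using T_rec[of m] \<phi>(2)[OF filtration_piece[OF w] filtration_piece[OF T]] \<phi>w by metis
  have distinct: "s (J l) \<noteq> s (J m)" if "m < l" for l m
    using kill[of "u (J l)" m l] su(2,3) that by metis
  \<comment> \<open>Earlier terms live in other summands, and the tail after \<open>m\<close> lies
    too deep in the filtration to have a component at \<open>s (J m)\<close>.\<close>
  have comp: "\<phi> 0 (T 0) (s (J m)) = u (J m)" for m
  proof -
    have skip: "l \<le> m \<Longrightarrow> \<phi> 0 (T 0) (s (J m)) = \<phi> 0 (T l) (s (J m))" for l
    proof (induction l)
      case (Suc l)
      then show ?case using \<phi>T[of l] distinct[of l m] by simp
    qed simp
    have "\<phi> 0 (T 0) (s (J m)) = \<phi> 0 (T m) (s (J m))" by (rule skip) simp
    also have "\<dots> = u (J m) + \<phi> 0 (T (Suc m)) (s (J m))" by (subst \<phi>T) simp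
    finally have "\<phi> 0 (T 0) (s (J m)) = u (J m) + \<phi> 0 (T (Suc m)) (s (J m))" .
    moreover have "\<phi> 0 (T (Suc m)) (s (J m)) = 0"
      using kill[OF filtration_sum_component[OF H\<phi>[OF T] su(1)]] by blast
    ultimately show ?thesis by simp
  qed
  have "range (s \<circ> J) \<subseteq> {i. \<phi> 0 (T 0) i \<noteq> 0}" using comp su(3) by auto
  moreover have "finite {i. \<phi> 0 (T 0) i \<noteq> 0}"
    using filtration_piece[OF H\<phi>[OF T]] by (auto simp: gmod_sum_def)
  moreover have "inj (s \<circ> J)"
    by (rule linorder_injI) (use distinct in \<open>auto simp: eq_commute\<close>)
  ultimately show False by (meson finite_subset finite_imageD infinite_UNIV_nat)
qed

theorem mainTheorem1:
  fixes d1 d2 :: int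
  assumes "0 < d1" and "d1 < d2"
  shows "graded_module d1 d2 (M_prod d1 d2 :: ('k::field, nat \<Rightarrow> flash_elt \<Rightarrow> 'k) gmod)
    \<and> bounded_below (M_prod d1 d2 :: ('k, nat \<Rightarrow> flash_elt \<Rightarrow> 'k) gmod)
    \<and> \<not> free_flash_coproduct TYPE('i) TYPE('j) TYPE('w::ab_group_add) d1 d2
          (M_prod d1 d2 :: ('k, nat \<Rightarrow> flash_elt \<Rightarrow> 'k) gmod)
    \<and> \<not> (\<forall>N :: ('k, nat \<Rightarrow> flash_elt \<Rightarrow> 'k) gmod.
          graded_module d1 d2 N \<longrightarrow>
          free_flash_coproduct TYPE('i) TYPE('j) TYPE('w) d1 d2 N)"
  using graded_module_M_prod[OF assms(2)] bounded_below_M_prod[OF assms]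
    M_prod_not_coproduct[OF assms] by blast

end
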